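(* Let $i\ge 0$ and $m\ge 0$ be integers. There is a bijection between the set of partial $2$-Motzkin paths of length $i$ with $m$ marked R-visible up steps and $m+1$ elevation lines such that there is exactly one marked step between any two adjacent elevation lines, and the set of free $3$-Motzkin paths of length $i$ with exactly $m$ dotted horizontal steps.
   Context: All paths start at $(0,0)$ and use steps $U=(1,1)$, $D=(1,-1)$, $H=(1,0)$; the length is the number of steps. A partial $2$-Motzkin path is such a path that never goes below the $x$-axis (with arbitrary endpoint) in which each horizontal step is of one of two kinds, straight or wavy. A free $3$-Motzkin path is such a path with no restriction (it may go below the $x$-axis and end anywhere) in which each horizontal step is of one of three kinds: straight, wavy or dotted. If a partial path ends at level (i.e. $y$-coordinate) $\ell$, then for each $h\in\{0,1,\dots,\ell-1\}$ the rightmost up step whose initial point has $y$-coordinate $h$ is called the R-visible up step at level $h$; so there are exactly $\ell$ R-visible up steps. An elevation line is a horizontal line $y=p$ with $p$ an integer, $0\le p\le \ell$. The marked objects are: a partial $2$-Motzkin path ending at some level $\ell$, together with a choice of $m$ marked R-visible up steps, at levels $y_1<y_2<\cdots<y_m$, and $m+1$ elevation lines $y=x_1,\dots,y=x_{m+1}$ with exactly one marked step between consecutive lines, i.e. $0\le x_1\le y_1$, $\;y_{r}+1\le x_{r+1}$ for $1\le r\le m$, $\;x_r\le y_r$ for $1\le r\le m$, and $x_{m+1}\le \ell$ (for $m=0$ just $0\le x_1\le \ell$). *)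

theory Defs
  imports Main
begin

datatype kind = Straight | Wavy | Dotted

datatype step = U | D | H kind

type_synonym path = "step list"

fun rise :: "step \<Rightarrow> int" where
  "rise U = 1"
| "rise D = -1"
| "rise (H _) = 0"

text \<open>A path is the list of its steps, starting at \<open>(0,0)\<close>.  The step \<open>w ! k\<close> has initial point
  \<open>(k, level w k)\<close>, and the path ends at level \<open>level w (length w)\<close>.\<close>

definition level :: "path \<Rightarrow> nat \<Rightarrow> int" where
  "level w k = sum_list (map rise (take k w))"

definition end_level :: "path \<Rightarrow> int" where
  "end_level w = level w (length w)"

definition partial_2_Motzkin :: "path \<Rightarrow> bool" where
  "partial_2_Motzkin w \<longleftrightarrow> H Dotted \<notin> set w \<and> (\<forall>k \<le> length w. 0 \<le> level w k)"

text \<open>A step is identified by its position \<open>k\<close> in the path, not by its value.  The bound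
  \<open>h < end_level w\<close> matters: there may be a rightmost up step from a level at or above the end
  level, but it does not count as R-visible.\<close>

definition R_visible_at :: "path \<Rightarrow> int \<Rightarrow> nat \<Rightarrow> bool" where
  "R_visible_at w h k \<longleftrightarrow>
     0 \<le> h \<and> h < end_level w \<and>
     k < length w \<and> w ! k = U \<and> level w k = h \<and>
     (\<forall>j. k < j \<and> j < length w \<and> w ! j = U \<longrightarrow> level w j \<noteq> h)"

definition R_visible_steps :: "path \<Rightarrow> nat set" where
  "R_visible_steps w = {k. \<exists>h. R_visible_at w h k}"

text \<open>The levels of a set \<open>M\<close> of (positions of) marked R-visible steps, in increasing order.
  Distinct R-visible steps have distinct levels, so this list has length \<open>card M\<close>.\<close>

definition marked_levels :: "path \<Rightarrow> nat set \<Rightarrow> int list" where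
  "marked_levels w M = sorted_list_of_set (level w ` M)"

text \<open>The elevation lines \<open>y = x\<^sub>1, \<dots>, y = x\<^bsub>m+1\<^esub>\<close> are given by the list of their heights. With
  0-based indexing, \<open>xs ! r\<close> is \<open>x\<^bsub>r+1\<^esub>\<close> and \<open>ys ! r\<close> is \<open>y\<^bsub>r+1\<^esub>\<close>.\<close>

definition elevation_lines :: "path \<Rightarrow> nat set \<Rightarrow> int list \<Rightarrow> bool" where
  "elevation_lines w M xs \<longleftrightarrow>
     (let m = card M; ys = marked_levels w M in
        length xs = m + 1 \<and>
        0 \<le> xs ! 0 \<and>
        (\<forall>r < m. xs ! r \<le> ys ! r \<and> ys ! r + 1 \<le> xs ! (r + 1)) \<and>
        xs ! m \<le> end_level w)"

definition marked_partial_paths :: "nat \<Rightarrow> nat \<Rightarrow> (path \<times> nat set \<times> int list) set" where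
  "marked_partial_paths i m =
     {(w, M, xs). length w = i \<and> partial_2_Motzkin w \<and>
        M \<subseteq> R_visible_steps w \<and> card M = m \<and> elevation_lines w M xs}"

text \<open>Every word over the steps is a free 3-Motzkin path.\<close>

definition free_paths :: "nat \<Rightarrow> nat \<Rightarrow> path set" where
  "free_paths i m = {w. length w = i \<and> count_list w (H Dotted) = m}"

end

theory Submission
  imports Defs
begin

text \<open>
  Both sets are finite, so it suffices that their cardinalities satisfy the same recurrence.  For
  free paths, deleting the first step gives \<open>F (i + 1) m = 4 F i m + F i (m - 1)\<close>.  For marked
  paths, the levels of the R-visible steps of a path with end level \<open>l\<close> are exactly
  \<open>0, \<dots>, l - 1\<close>, so the number \<open>t l m\<close> of decorations depends only on \<open>l\<close> and \<open>m\<close>: it counts the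
  chains \<open>0 \<le> x\<^sub>1 \<le> y\<^sub>1 < x\<^sub>2 \<le> \<dots> \<le> y\<^sub>m < x\<^bsub>m+1\<^esub> \<le> l\<close>.  Summing over the last step of a path replaces
  \<open>t l m\<close> by \<open>t (l + 1) m + 2 t l m + t (l - 1) m\<close>, where \<open>t (-1) m = 0\<close> accounts for the
  forbidden down step from level \<open>0\<close>.  As \<open>t\<close> has second difference
  \<open>t (l + 1) m - 2 t l m + t (l - 1) m = t l (m - 1)\<close>, this is \<open>4 t l m + t l (m - 1)\<close>.
\<close>

section \<open>Interlacing chains\<close>

text \<open>This is the condition of \<open>elevation_lines\<close> with the path forgotten. The
  bound \<open>l\<close> is an integer so that \<open>l = -1\<close>, where no chain exists, can
  serve as boundary value.\<close>

definition interlacing :: "int \<Rightarrow> nat \<Rightarrow> (int list \<times> int list) set" where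
  "interlacing l m = {(ys, xs). length ys = m \<and> length xs = m + 1 \<and> 0 \<le> xs ! 0 \<and>
     (\<forall>r < m. xs ! r \<le> ys ! r \<and> ys ! r + 1 \<le> xs ! (r + 1)) \<and> xs ! m \<le> l}"

lemma interlacing_0: "interlacing l 0 = (\<lambda>x. ([], [x])) ` {0..l}"
  by (auto simp: interlacing_def length_Suc_conv)

text \<open>Once the last line and the last marked level \<open>y\<close> are removed, the remaining
  lines lie at height at most \<open>y\<close>, so \<open>y\<close> takes over the role of the bound
  \<open>l\<close>.\<close>

lemma interlacing_snoc:
  "(ys @ [y], xs @ [x]) \<in> interlacing l (Suc m) \<longleftrightarrow>
     (ys, xs) \<in> interlacing y m \<and> y < x \<and> x \<le> l"
proof (cases "length ys = m \<and> length xs = m + 1")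
  case True
  have "(\<forall>r < Suc m. P r) \<longleftrightarrow> (\<forall>r < m. P r) \<and> P m" for P
    using less_Suc_eq by auto
  with True show ?thesis by (auto simp: interlacing_def nth_append)
qed (auto simp: interlacing_def)

lemma interlacing_nonneg:
  assumes "(ys, xs) \<in> interlacing l m"
  shows "0 \<le> l"
  using assms
proof (induction m arbitrary: l ys xs)
  case 0
  then show ?case by (auto simp: interlacing_def)
next
  case (Suc m)
  then have "ys \<noteq> []" "xs \<noteq> []" by (auto simp: interlacing_def)
  then obtain ys' y xs' x where "ys = ys' @ [y]" "xs = xs' @ [x]"
    by (metis rev_exhaust)
  with Suc show ?case by (fastforce simp: interlacing_snoc)
qed

text \<open>Nested finite ranges for \<open>x\<close> and \<open>y\<close> give both finiteness and
  a double sum for the cardinality. The lower bounds on \<open>x\<close> and \<open>y\<close> come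
  from \<open>interlacing_nonneg\<close>.\<close>

lemma interlacing_Suc:
  "interlacing l (Suc m) = (\<lambda>(x, y, ys, xs). (ys @ [y], xs @ [x])) `
     (SIGMA x:{0..l}. SIGMA y:{0..<x}. interlacing y m)" (is "?L = ?f ` ?R")
proof (rule set_eqI, safe)
  fix ys xs assume *: "(ys, xs) \<in> ?L"
  then have "ys \<noteq> []" "xs \<noteq> []" by (auto simp: interlacing_def)
  then obtain ys' y xs' x where eq: "ys = ys' @ [y]" "xs = xs' @ [x]"
    by (metis rev_exhaust)
  with * have "(ys', xs') \<in> interlacing y m" "y < x" "x \<le> l"
    by (simp_all add: interlacing_snoc)
  with interlacing_nonneg have "(x, y, ys', xs') \<in> ?R" by fastforce
  then show "(ys, xs) \<in> ?f ` ?R" unfolding eq by (rule rev_image_eqI) simp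
qed (simp add: interlacing_snoc)

lemma finite_interlacing: "finite (interlacing l m)"
  by (induction m arbitrary: l) (auto simp: interlacing_0 interlacing_Suc)

lemma card_interlacing_0: "card (interlacing l 0) = nat (l + 1)"
  by (simp add: interlacing_0 card_image inj_on_def)

lemma card_interlacing_Suc:
  "card (interlacing l (Suc m)) = (\<Sum>x\<in>{0..l}. \<Sum>y\<in>{0..<x}. card (interlacing y m))"
  unfolding interlacing_Suc
  by (subst card_image) (auto simp: inj_on_def card_SigmaI finite_interlacing)

lemma card_interlacing_neg: "card (interlacing (-1) m) = 0"
  by (cases m) (simp_all add: card_interlacing_0 card_interlacing_Suc)

lemma card_interlacing_second_diff_0:
  assumes "0 \<le> l"
  shows "card (interlacing (l + 1) 0) + card (interlacing (l - 1) 0) = 2 * card (interlacing l 0)"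
  using assms by (simp add: card_interlacing_0)

text \<open>Passing from \<open>l - 1\<close> to \<open>l\<close>, and from \<open>l\<close> to
  \<open>l + 1\<close>, adds one inner sum each time, at \<open>x = l\<close> and at
  \<open>x = l + 1\<close>. These two inner sums differ by the single term
  \<open>y = l\<close>.\<close>

lemma card_interlacing_second_diff_Suc:
  assumes "0 \<le> l"
  shows "card (interlacing (l + 1) (Suc m)) + card (interlacing (l - 1) (Suc m)) =
    2 * card (interlacing l (Suc m)) + card (interlacing l m)"
proof -
  have "{0..l + 1} = insert (l + 1) {0..l}" "{0..l} = insert l {0..l - 1}"
    "{0..<l + 1} = insert l {0..<l}"
    using assms by auto
  then show ?thesis by (simp add: card_interlacing_Suc)
qed

section \<open>Levels of R-visible steps\<close>

lemma level_Suc: "k < length w \<Longrightarrow> level w (Suc k) = level w k + rise (w ! k)"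
  by (simp add: level_def take_Suc_conv_app_nth)

lemma R_visible_at_unique:
  assumes "R_visible_at w h j" "R_visible_at w h k"
  shows "j = k"
  using assms by (metis R_visible_at_def linorder_neqE_nat)

lemma R_visible_at_exists:
  assumes "0 \<le> h" "h < end_level w"
  shows "\<exists>k. R_visible_at w h k"
proof -
  \<comment> \<open>The last position at level at most \<open>h\<close>; position 0 is a candidate
    because \<open>0 \<le> h\<close>.\<close>
  define k where "k = Max {k. k \<le> length w \<and> level w k \<le> h}"
  have fin: "finite {k. k \<le> length w \<and> level w k \<le> h}" by simp
  have "0 \<in> {k. k \<le> length w \<and> level w k \<le> h}" using assms by (simp add: level_def)
  with Max_in[OF fin] have "k \<in> {k. k \<le> length w \<and> level w k \<le> h}" unfolding k_def by blast
  then have k: "k \<le> length w" "level w k \<le> h" by simp_all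
  have above: "h < level w j" if "k < j" "j \<le> length w" for j
    using Max_ge[OF fin, of j] that unfolding k_def by fastforce
  have less: "k < length w"
    using k assms by (cases "k = length w") (auto simp: end_level_def)
  have "h < level w k + rise (w ! k)"
    using above[of "Suc k"] less by (simp add: level_Suc)
  \<comment> \<open>A step rises by at most 1, so crossing from level at most \<open>h\<close> to
    above \<open>h\<close> forces an up step starting exactly at \<open>h\<close>.\<close>
  with k have "w ! k = U" "level w k = h" by (cases "w ! k"; simp)+
  with less assms above have "R_visible_at w h k"
    by (fastforce simp: R_visible_at_def)
  then show ?thesis ..
qed

text \<open>Existence and uniqueness at each level below the end level make marking R-visible steps
  the same as choosing such levels.\<close>

lemma bij_betw_level_R_visible:
  "bij_betw (level w) (R_visible_steps w) {0..<end_level w}"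
proof -
  have visible: "R_visible_at w (level w k) k" if "k \<in> R_visible_steps w" for k
    using that by (auto simp: R_visible_steps_def R_visible_at_def)
  then have "inj_on (level w) (R_visible_steps w)"
    by (metis inj_onI R_visible_at_unique)
  moreover have "level w ` R_visible_steps w = {0..<end_level w}"
  proof
    show "level w ` R_visible_steps w \<subseteq> {0..<end_level w}"
      using visible by (auto simp: R_visible_at_def)
    show "{0..<end_level w} \<subseteq> level w ` R_visible_steps w"
    proof
      fix h assume "h \<in> {0..<end_level w}"
      then obtain k where "R_visible_at w h k" using R_visible_at_exists by auto
      then have "k \<in> R_visible_steps w" "h = level w k"
        by (auto simp: R_visible_steps_def R_visible_at_def)
      then show "h \<in> level w ` R_visible_steps w" by blast
    qed
  qed
  ultimately show ?thesis by (simp add: bij_betw_def)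
qed

lemma finite_R_visible_steps: "finite (R_visible_steps w)"
  by (rule finite_subset[of _ "{..<length w}"]) (auto simp: R_visible_steps_def R_visible_at_def)

section \<open>Decorations of a fixed path\<close>

definition decorations :: "path \<Rightarrow> nat \<Rightarrow> (nat set \<times> int list) set" where
  "decorations w m = {(M, xs). M \<subseteq> R_visible_steps w \<and> card M = m \<and> elevation_lines w M xs}"

text \<open>The lines separate the marked levels and keep them between 0 and \<open>l\<close>. Hence
  \<open>ys\<close> is determined by its set of entries, and for \<open>l = end_level w\<close> each
  entry is the level of an R-visible step.\<close>

lemma interlacing_sorted:
  assumes "(ys, xs) \<in> interlacing l m"
  shows "sorted_wrt (<) ys" "set ys \<subseteq> {0..<l}"
proof -
  have "sorted_wrt (<) ys \<and> set ys \<subseteq> {0..<l}"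
    using assms
  proof (induction m arbitrary: l ys xs)
    case 0
    then show ?case by (auto simp: interlacing_def)
  next
    case (Suc m)
    from Suc.prems obtain x y ys' xs' where *: "ys = ys' @ [y]" "x \<le> l" "0 \<le> y" "y < x"
      "(ys', xs') \<in> interlacing y m"
      by (auto simp: interlacing_Suc)
    with Suc.IH[OF *(5)] show ?case by (auto simp: sorted_wrt_append)
  qed
  then show "sorted_wrt (<) ys" "set ys \<subseteq> {0..<l}" by simp_all
qed

lemma bij_betw_decorations:
  "bij_betw (\<lambda>(M, xs). (marked_levels w M, xs)) (decorations w m) (interlacing (end_level w) m)"
    (is "bij_betw ?f _ _")
proof (rule bij_betw_imageI)
  have inj: "inj_on (level w) (R_visible_steps w)"
    and img: "level w ` R_visible_steps w = {0..<end_level w}"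
    using bij_betw_level_R_visible[of w] by (auto simp: bij_betw_def)
  have set_marked: "set (marked_levels w M) = level w ` M"
    and length_marked: "length (marked_levels w M) = card M" if "M \<subseteq> R_visible_steps w" for M
  proof -
    have "finite M" using that finite_R_visible_steps finite_subset by blast
    then show "set (marked_levels w M) = level w ` M" by (simp add: marked_levels_def)
    show "length (marked_levels w M) = card M"
      using card_image[OF inj_on_subset[OF inj that]] by (simp add: marked_levels_def)
  qed
  show "inj_on ?f (decorations w m)"
  proof -
    have "M = N" if "M \<subseteq> R_visible_steps w" "N \<subseteq> R_visible_steps w"
      "marked_levels w M = marked_levels w N" for M N
      using that set_marked inj by (metis inj_on_image_eq_iff)
    then show ?thesis by (auto simp: inj_on_def decorations_def)
  qed
  show "?f ` decorations w m = interlacing (end_level w) m"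
  proof (rule set_eqI, safe)
    fix M xs assume "(M, xs) \<in> decorations w m"
    then show "(marked_levels w M, xs) \<in> interlacing (end_level w) m"
      using length_marked by (auto simp: decorations_def elevation_lines_def interlacing_def Let_def)
  next
    fix ys xs assume *: "(ys, xs) \<in> interlacing (end_level w) m"
    note ys = interlacing_sorted[OF *]
    then have "set ys \<subseteq> level w ` R_visible_steps w" using img by simp
    \<comment> \<open>Surjectivity: the entries of \<open>ys\<close> are pulled back to steps.
      Sorting their levels returns \<open>ys\<close> because it is strictly increasing.\<close>
    then obtain M where M: "M \<subseteq> R_visible_steps w" "set ys = level w ` M"
      by (auto simp: subset_image_iff)
    have "marked_levels w M = ys"
      unfolding marked_levels_def M(2)[symmetric]
      by (rule sorted_list_of_set.idem_if_sorted_distinct)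
         (use ys(1) in \<open>auto simp: strict_sorted_iff\<close>)
    moreover from this M have "(M, xs) \<in> decorations w m"
      using * length_marked[of M]
      by (auto simp: decorations_def elevation_lines_def interlacing_def Let_def)
    ultimately show "(ys, xs) \<in> ?f ` decorations w m" by force
  qed
qed

lemma card_decorations: "card (decorations w m) = card (interlacing (end_level w) m)"
  using bij_betw_decorations by (rule bij_betw_same_card)

lemma finite_decorations: "finite (decorations w m)"
  using bij_betw_finite[OF bij_betw_decorations] finite_interlacing by simp

section \<open>Partial paths\<close>

definition partial_paths :: "nat \<Rightarrow> path set" where
  "partial_paths i = {w. length w = i \<and> partial_2_Motzkin w}"

lemma level_append_le: "k \<le> length w \<Longrightarrow> level (w @ v) k = level w k"
  by (simp add: level_def)

lemma end_level_snoc: "end_level (w @ [s]) = end_level w + rise s"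
  by (simp add: end_level_def level_def)

lemma partial_2_Motzkin_snoc:
  "partial_2_Motzkin (w @ [s]) \<longleftrightarrow>
     partial_2_Motzkin w \<and> s \<noteq> H Dotted \<and> 0 \<le> end_level w + rise s"
proof -
  have "(\<forall>k \<le> length (w @ [s]). 0 \<le> level (w @ [s]) k) \<longleftrightarrow>
      (\<forall>k \<le> length w. 0 \<le> level (w @ [s]) k) \<and> 0 \<le> end_level (w @ [s])"
    unfolding end_level_def length_append_singleton le_Suc_eq by blast
  then show ?thesis
    by (auto simp: partial_2_Motzkin_def level_append_le end_level_snoc)
qed

lemma partial_2_Motzkin_end_level: "partial_2_Motzkin w \<Longrightarrow> 0 \<le> end_level w"
  by (simp add: partial_2_Motzkin_def end_level_def)

lemma partial_paths_0: "partial_paths 0 = {[]}"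
  by (auto simp: partial_paths_def partial_2_Motzkin_def level_def)

lemma not_Dotted_iff: "s \<noteq> H Dotted \<longleftrightarrow> s \<in> {U, D, H Straight, H Wavy}"
proof (cases s)
  case (H k)
  then show ?thesis by (cases k) auto
qed auto

lemma partial_paths_Suc:
  "partial_paths (Suc i) = (\<lambda>(w, s). w @ [s]) `
     (SIGMA w:partial_paths i. {s \<in> {U, D, H Straight, H Wavy}. 0 \<le> end_level w + rise s})"
proof (rule set_eqI)
  fix v
  show "v \<in> partial_paths (Suc i) \<longleftrightarrow> v \<in> (\<lambda>(w, s). w @ [s]) `
     (SIGMA w:partial_paths i. {s \<in> {U, D, H Straight, H Wavy}. 0 \<le> end_level w + rise s})"
    by (cases v rule: rev_cases)
       (auto simp: partial_paths_def partial_2_Motzkin_snoc not_Dotted_iff image_iff)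
qed

lemma finite_partial_paths: "finite (partial_paths i)"
  by (induction i) (auto simp: partial_paths_0 partial_paths_Suc)

text \<open>Since \<open>f\<close> vanishes at -1, the forbidden down step from level 0 may be
  included with weight 0, and all four undotted steps can be summed uniformly.\<close>

lemma sum_partial_paths_Suc:
  fixes f :: "int \<Rightarrow> nat"
  assumes "f (-1) = 0"
  shows "(\<Sum>w\<in>partial_paths (Suc i). f (end_level w)) =
    (\<Sum>w\<in>partial_paths i.
       f (end_level w + 1) + 2 * f (end_level w) + f (end_level w - 1))"
proof -
  let ?S = "\<lambda>w. {s \<in> {U, D, H Straight, H Wavy}. 0 \<le> end_level w + rise s}"
  have "(\<Sum>w\<in>partial_paths (Suc i). f (end_level w)) =
      (\<Sum>(w, s)\<in>Sigma (partial_paths i) ?S. f (end_level w + rise s))"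
    unfolding partial_paths_Suc
    by (subst sum.reindex) (auto simp: inj_on_def end_level_snoc intro!: sum.cong)
  also have "\<dots> = (\<Sum>w\<in>partial_paths i. \<Sum>s\<in>?S w. f (end_level w + rise s))"
    by (rule sum.Sigma[symmetric]) (simp_all add: finite_partial_paths)
  also have "\<dots> = (\<Sum>w\<in>partial_paths i. \<Sum>s\<in>{U, D, H Straight, H Wavy}. f (end_level w + rise s))"
  proof (rule sum.cong[OF refl], rule sum.mono_neutral_left)
    fix w assume "w \<in> partial_paths i"
    then have "0 \<le> end_level w" by (simp add: partial_paths_def partial_2_Motzkin_end_level)
    \<comment> \<open>No step falls by more than 1, so an excluded step can only lead from level 0
      to level -1.\<close>
    then have "end_level w + rise s = -1" if "s \<in> {U, D, H Straight, H Wavy} - ?S w" for s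
      using that by auto
    then show "\<forall>s\<in>{U, D, H Straight, H Wavy} - ?S w. f (end_level w + rise s) = 0"
      using assms by metis
  qed auto
  finally show ?thesis by (simp add: ac_simps mult_2)
qed

section \<open>The recurrences\<close>

lemma marked_partial_paths_Sigma:
  "marked_partial_paths i m = (SIGMA w:partial_paths i. decorations w m)"
  by (auto simp: marked_partial_paths_def partial_paths_def decorations_def)

lemma finite_marked_partial_paths: "finite (marked_partial_paths i m)"
  by (simp add: marked_partial_paths_Sigma finite_partial_paths finite_decorations)

lemma card_marked_partial_paths:
  "card (marked_partial_paths i m) = (\<Sum>w\<in>partial_paths i. card (interlacing (end_level w) m))"
  by (simp add: marked_partial_paths_Sigma card_SigmaI finite_partial_paths finite_decorations
      card_decorations)

text \<open>The empty path ends at level 0, which leaves room for one elevation line but for no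
  marked step.\<close>

lemma card_marked_partial_paths_0: "card (marked_partial_paths 0 m) = (if m = 0 then 1 else 0)"
  by (cases m) (simp_all add: card_marked_partial_paths partial_paths_0 end_level_def level_def
      card_interlacing_0 card_interlacing_Suc)

lemma card_marked_partial_paths_Suc:
  "card (marked_partial_paths (Suc i) m) = 4 * card (marked_partial_paths i m) +
     (case m of 0 \<Rightarrow> 0 | Suc n \<Rightarrow> card (marked_partial_paths i n))"
proof -
  let ?t = "\<lambda>l. card (interlacing l m)"
  \<comment> \<open>The two horizontal steps add \<open>2 * ?t l\<close> to both sides of the
    second-difference identity; for \<open>m = 0\<close> the second difference is zero.\<close>
  have step: "?t (l + 1) + 2 * ?t l + ?t (l - 1) =
      4 * ?t l + (case m of 0 \<Rightarrow> 0 | Suc n \<Rightarrow> card (interlacing l n))" if "0 \<le> l" for l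
    using card_interlacing_second_diff_0[OF that] card_interlacing_second_diff_Suc[OF that]
    by (cases m) (simp_all add: algebra_simps)
  have "card (marked_partial_paths (Suc i) m) = (\<Sum>w\<in>partial_paths i.
      ?t (end_level w + 1) + 2 * ?t (end_level w) + ?t (end_level w - 1))"
    unfolding card_marked_partial_paths
    by (rule sum_partial_paths_Suc) (rule card_interlacing_neg)
  also have "\<dots> = (\<Sum>w\<in>partial_paths i. 4 * ?t (end_level w) +
      (case m of 0 \<Rightarrow> 0 | Suc n \<Rightarrow> card (interlacing (end_level w) n)))"
    by (intro sum.cong refl step) (simp add: partial_paths_def partial_2_Motzkin_end_level)
  also have "\<dots> = 4 * card (marked_partial_paths i m) +
     (case m of 0 \<Rightarrow> 0 | Suc n \<Rightarrow> card (marked_partial_paths i n))"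
    by (cases m) (simp_all add: card_marked_partial_paths sum.distrib sum_distrib_left)
  finally show ?thesis .
qed

lemma free_paths_0: "free_paths 0 m = (if m = 0 then {[]} else {})"
  by (auto simp: free_paths_def)

text \<open>With no level condition, the first step can be removed freely; a dotted one uses up one
  of the \<open>m\<close> dotted steps.\<close>

lemma free_paths_Suc:
  "free_paths (Suc i) m = (\<lambda>(s, w). s # w) ` ({U, D, H Straight, H Wavy} \<times> free_paths i m) \<union>
     (case m of 0 \<Rightarrow> {} | Suc n \<Rightarrow> Cons (H Dotted) ` free_paths i n)"
proof (rule set_eqI)
  fix v
  show "v \<in> free_paths (Suc i) m \<longleftrightarrow>
    v \<in> (\<lambda>(s, w). s # w) ` ({U, D, H Straight, H Wavy} \<times> free_paths i m) \<union>
      (case m of 0 \<Rightarrow> {} | Suc n \<Rightarrow> Cons (H Dotted) ` free_paths i n)"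
  proof (cases v)
    case Nil
    then show ?thesis by (auto simp: free_paths_def split: nat.split)
  next
    case (Cons s w)
    then show ?thesis
      using not_Dotted_iff[of s]
      by (cases "s = H Dotted") (auto simp: free_paths_def image_iff split: nat.split)
  qed
qed

lemma finite_free_paths: "finite (free_paths i m)"
  by (induction i arbitrary: m) (auto simp: free_paths_0 free_paths_Suc split: nat.split)

lemma card_free_paths_Suc:
  "card (free_paths (Suc i) m) = 4 * card (free_paths i m) +
     (case m of 0 \<Rightarrow> 0 | Suc n \<Rightarrow> card (free_paths i n))"
proof -
  have inj: "inj_on (\<lambda>(s, w). s # w) ({U, D, H Straight, H Wavy} \<times> free_paths i m)"
    by (auto simp: inj_on_def)
  have "card (free_paths (Suc i) m) =
      card ((\<lambda>(s, w). s # w) ` ({U, D, H Straight, H Wavy} \<times> free_paths i m)) +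
      card (case m of 0 \<Rightarrow> {} | Suc n \<Rightarrow> Cons (H Dotted) ` free_paths i n)"
    unfolding free_paths_Suc
    by (rule card_Un_disjoint) (auto simp: finite_free_paths split: nat.split)
  also have "\<dots> = 4 * card (free_paths i m) +
     (case m of 0 \<Rightarrow> 0 | Suc n \<Rightarrow> card (free_paths i n))"
    unfolding card_image[OF inj]
    by (cases m) (simp_all add: card_cartesian_product card_image)
  finally show ?thesis .
qed

text \<open>Equal initial values and equal recurrences. The induction keeps \<open>m\<close>
  arbitrary because the recurrence also refers to its predecessor.\<close>

lemma card_marked_eq_card_free: "card (marked_partial_paths i m) = card (free_paths i m)"
  by (induction i arbitrary: m)
     (simp_all add: card_marked_partial_paths_0 free_paths_0 card_marked_partial_paths_Suc
       card_free_paths_Suc split: nat.split)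

theorem theorem5p2:
  fixes i m :: nat
  shows "\<exists>f. bij_betw f (marked_partial_paths i m) (free_paths i m)"
  using finite_marked_partial_paths finite_free_paths card_marked_eq_card_free
  by (rule finite_same_card_bij)

end
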